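(* The $\mathbb{C}$-algebra embedding $\mathrm{Sk}_{A,\lambda}(S_{1,1})\rightarrow\mathcal{SH}_{q,t}(A_1)$ from the relative skein algebra of the once-punctured torus to the spherical double affine Hecke algebra of type $A_1$ given by $$A\mapsto q^{-\frac12},\quad \lambda\mapsto q^{-1}t,\quad \alpha\mapsto x,\quad \beta\mapsto y,\quad \gamma\mapsto z$$ is $\mathrm{SL}_2(\mathbb{Z})$-equivariant.
   Context: $\mathrm{Sk}_{A,\lambda}(S_{1,1})$ is the associative unital $\mathbb{C}[A^{\pm1},\lambda^{\pm1}]$-algebra generated by $\alpha,\beta,\gamma$ with relations $A^{-1}\alpha\beta-A\beta\alpha=(A^{-2}-A^2)\gamma$, $A^{-1}\beta\gamma-A\gamma\beta=(A^{-2}-A^2)\alpha$, $A^{-1}\gamma\alpha-A\alpha\gamma=(A^{-2}-A^2)\beta$, and $A^{-2}\alpha^2+A^2\beta^2+A^{-2}\gamma^2-A^{-1}\alpha\beta\gamma=A^2+A^{-2}+\lambda+\lambda^{-1}$. Let $\gamma_{-1}=A^{-1}\alpha\beta-A^{-2}\gamma$ (this is the class of the simple closed curve for which $(A+A^{-1})\gamma_{-1}=\alpha\beta+\beta\alpha-(A+A^{-1})\gamma$). Let $\mathbb{C}_{q,t}=\mathbb{C}(q^{1/2},t^{1/2})$. The DAHA $\mathcal{H}_{q,t}(A_1)$ is the $\mathbb{C}_{q,t}$-algebra generated by $T,X^{\pm1},Y^{\pm1}$ with relations $TXT=X^{-1}$, $TY^{-1}T=Y$, $Y^{-1}X^{-1}YXT^2=q^{-1}$,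 $(T-t^{1/2})(T+t^{-1/2})=0$. Let $e=(t^{1/2}+t^{-1/2})^{-1}(T+t^{-1/2})$, an idempotent, and $\mathcal{SH}_{q,t}(A_1)=e\,\mathcal{H}_{q,t}(A_1)\,e$, an algebra with unit $e$. Set $x=(X+X^{-1})e$, $y=(Y+Y^{-1})e$, $z=(q^{1/2}YX+q^{-1/2}X^{-1}Y^{-1})e$, and $z'=\dfrac{xy+yx}{q^{1/2}+q^{-1/2}}-z$. The given assignment is known to be a well-defined $\mathbb{C}$-algebra embedding. The group $\mathrm{SL}_2(\mathbb{Z})$ is generated by $\tau_+,\tau_-,\sigma$ with $\sigma=\tau_+\tau_-^{-1}\tau_+$. It acts on $\mathrm{Sk}_{A,\lambda}(S_{1,1})$ by $\mathbb{C}[A^{\pm1},\lambda^{\pm1}]$-algebra automorphisms (the mapping class group action, where $\tau_\pm$ are Dehn twists around $\alpha$, $\beta$): $\tau_+:(\alpha,\beta,\gamma)\mapsto(\alpha,\gamma_{-1},\beta)$; $\tau_-:(\alpha,\beta,\gamma)\mapsto(\gamma_{-1},\beta,\alpha)$; $\sigma:(\alpha,\beta,\gamma)\mapsto(\beta,\alpha,\gamma_{-1})$. It acts on $\mathcal{SH}_{q,t}(A_1)$ by $\mathbb{C}_{q,t}$-algebra automorphisms: $\tau_+:(x,y,z)\mapsto(x,z',y)$; $\tau_-:(x,y,z)\mapsto(z',y,x)$; $\sigma:(x,y,z)\mapsto(y,x,z')$. *)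

theory Defs
  imports
    "HOL-Library.Poly_Mapping"
    "HOL-Library.Product_Plus"
    "HOL-Computational_Algebra.Polynomial"
    "HOL-Computational_Algebra.Fraction_Field"
    "HOL-Algebra.QuotRing"
    "HOL-Algebra.Group_Action"
    "HOL-Analysis.Determinants"
begin

section \<open>Algebras presented by generators and relations\<close>

text \<open>Words form the free monoid, written additively so that the convolution product on
  finitely supported functions \<open>'g word \<Rightarrow>\<^sub>0 'r\<close> is the product of the free associative unital
  \<open>'r\<close>-algebra on \<open>'g\<close>.\<close>

datatype 'g word = Word (letters: "'g list")

instantiation word :: (type) monoid_add
begin

definition zero_word :: "'a word" where
  "0 = Word []"

definition plus_word :: "'a word \<Rightarrow> 'a word \<Rightarrow> 'a word" where
  "v + w = Word (letters v @ letters w)"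

instance
  by standard (simp_all add: zero_word_def plus_word_def)

end

definition gen :: "'g \<Rightarrow> 'g word \<Rightarrow>\<^sub>0 'r::comm_ring_1" where
  "gen a = Poly_Mapping.single (Word [a]) 1"

definition cst :: "'r \<Rightarrow> 'g word \<Rightarrow>\<^sub>0 'r::comm_ring_1" where
  "cst c = Poly_Mapping.single 0 c"

definition free_alg :: "('g word \<Rightarrow>\<^sub>0 'r::comm_ring_1) ring" where
  "free_alg = \<lparr>carrier = UNIV, mult = (*), one = 1, zero = 0, add = (+)\<rparr>"

text \<open>Each element \<open>p\<close> of the set of relations stands for the relation \<open>p = 0\<close>.\<close>

definition presented_alg ::
    "('g word \<Rightarrow>\<^sub>0 'r::comm_ring_1) set \<Rightarrow> ('g word \<Rightarrow>\<^sub>0 'r) set ring" where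
  "presented_alg rels = free_alg Quot (Idl\<^bsub>free_alg\<^esub> rels)"

definition pres_class ::
    "('g word \<Rightarrow>\<^sub>0 'r::comm_ring_1) set \<Rightarrow> ('g word \<Rightarrow>\<^sub>0 'r) \<Rightarrow> ('g word \<Rightarrow>\<^sub>0 'r) set" where
  "pres_class rels p = (Idl\<^bsub>free_alg\<^esub> rels) +>\<^bsub>free_alg\<^esub> p"

text \<open>An algebra over \<open>'r\<close> is given as a ring \<open>S\<close> with its structure map \<open>\<eta>\<close>, \<open>\<eta> c = c \<cdot> 1\<close>;
  an algebra homomorphism is a unital ring homomorphism compatible with the structure maps.\<close>

definition alg_hom ::
    "('r \<Rightarrow> 'a) \<Rightarrow> ('r \<Rightarrow> 'b) \<Rightarrow> ('a, 'm) ring_scheme \<Rightarrow> ('b, 'n) ring_scheme \<Rightarrow> ('a \<Rightarrow> 'b) set" where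
  "alg_hom \<eta> \<eta>' S S' = {f \<in> ring_hom S S'. \<forall>c. f (\<eta> c) = \<eta>' c}"

definition acts_by_alg_automorphisms ::
    "('g, 'k) monoid_scheme \<Rightarrow> ('r \<Rightarrow> 'a) \<Rightarrow> ('a, 'm) ring_scheme \<Rightarrow> ('g \<Rightarrow> 'a \<Rightarrow> 'a) \<Rightarrow> bool" where
  "acts_by_alg_automorphisms G \<eta> S \<rho> \<longleftrightarrow>
     group_action G (carrier S) \<rho> \<and> (\<forall>g\<in>carrier G. \<rho> g \<in> alg_hom \<eta> \<eta> S S)"


section \<open>The relative skein algebra of the once-punctured torus\<close>

text \<open>\<open>\<complex>[A\<^sup>\<plusminus>\<^sup>1, \<lambda>\<^sup>\<plusminus>\<^sup>1]\<close> as the group algebra of \<open>\<int> \<times> \<int>\<close>; the exponent pair is that of \<open>A\<close> and \<open>\<lambda>\<close>.\<close>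

type_synonym laurent = "(int \<times> int) \<Rightarrow>\<^sub>0 complex"

definition laurent_const :: "complex \<Rightarrow> laurent" where
  "laurent_const c = Poly_Mapping.single 0 c"

definition A_pow :: "int \<Rightarrow> laurent" where
  "A_pow n = Poly_Mapping.single (n, 0) 1"

definition lambda_pow :: "int \<Rightarrow> laurent" where
  "lambda_pow n = Poly_Mapping.single (0, n) 1"

datatype skein_gen = Alpha | Beta | Gamma

type_synonym skein_free = "skein_gen word \<Rightarrow>\<^sub>0 laurent"

definition skein_rels :: "skein_free set" where
  "skein_rels =
    (let \<alpha> = gen Alpha; \<beta> = gen Beta; \<gamma> = gen Gamma; A = (\<lambda>n. cst (A_pow n)); L = (\<lambda>n. cst (lambda_pow n)) in
     { A (-1) * \<alpha> * \<beta> - A 1 * \<beta> * \<alpha> - (A (-2) - A 2) * \<gamma>,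
       A (-1) * \<beta> * \<gamma> - A 1 * \<gamma> * \<beta> - (A (-2) - A 2) * \<alpha>,
       A (-1) * \<gamma> * \<alpha> - A 1 * \<alpha> * \<gamma> - (A (-2) - A 2) * \<beta>,
       A (-2) * \<alpha>^2 + A 2 * \<beta>^2 + A (-2) * \<gamma>^2 - A (-1) * \<alpha> * \<beta> * \<gamma>
         - (A 2 + A (-2) + L 1 + L (-1)) })"

definition Sk :: "skein_free set ring" where
  "Sk = presented_alg skein_rels"

definition sk_scalar :: "laurent \<Rightarrow> skein_free set" where
  "sk_scalar c = pres_class skein_rels (cst c)"

definition sk_alpha :: "skein_free set" where
  "sk_alpha = pres_class skein_rels (gen Alpha)"

definition sk_beta :: "skein_free set" where
  "sk_beta = pres_class skein_rels (gen Beta)"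

definition sk_gamma :: "skein_free set" where
  "sk_gamma = pres_class skein_rels (gen Gamma)"

definition sk_gamma_minus1 :: "skein_free set" where
  "sk_gamma_minus1 = pres_class skein_rels
     (cst (A_pow (-1)) * gen Alpha * gen Beta - cst (A_pow (-2)) * gen Gamma)"


section \<open>The spherical double affine Hecke algebra of type \<open>A\<^sub>1\<close>\<close>

text \<open>\<open>\<complex>(q\<^sup>1\<^sup>/\<^sup>2, t\<^sup>1\<^sup>/\<^sup>2)\<close>: the inner polynomial variable is \<open>q\<^sup>1\<^sup>/\<^sup>2\<close>, the outer one \<open>t\<^sup>1\<^sup>/\<^sup>2\<close>.\<close>

type_synonym Cqt = "complex poly poly fract"

definition Cqt_const :: "complex \<Rightarrow> Cqt" where
  "Cqt_const c = Fract [:[:c:]:] 1"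

definition q_half :: Cqt where
  "q_half = Fract [:[:0, 1:]:] 1"

definition t_half :: Cqt where
  "t_half = Fract [:0, 1:] 1"

datatype daha_gen = T_gen | X_gen | Xinv_gen | Y_gen | Yinv_gen

type_synonym daha_free = "daha_gen word \<Rightarrow>\<^sub>0 Cqt"

definition daha_rels :: "daha_free set" where
  "daha_rels =
    { gen X_gen * gen Xinv_gen - 1, gen Xinv_gen * gen X_gen - 1,
      gen Y_gen * gen Yinv_gen - 1, gen Yinv_gen * gen Y_gen - 1,
      gen T_gen * gen X_gen * gen T_gen - gen Xinv_gen,
      gen T_gen * gen Yinv_gen * gen T_gen - gen Y_gen,
      gen Yinv_gen * gen Xinv_gen * gen Y_gen * gen X_gen * (gen T_gen)^2 - cst (inverse (q_half^2)),
      (gen T_gen - cst t_half) * (gen T_gen + cst (inverse t_half)) }"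

definition DAHA :: "daha_free set ring" where
  "DAHA = presented_alg daha_rels"

text \<open>Representatives, in the free algebra, of the idempotent and of the generators of the
  spherical subalgebra.\<close>

definition e_free :: daha_free where
  "e_free = cst (inverse (t_half + inverse t_half)) * (gen T_gen + cst (inverse t_half))"

definition x_free :: daha_free where
  "x_free = (gen X_gen + gen Xinv_gen) * e_free"

definition y_free :: daha_free where
  "y_free = (gen Y_gen + gen Yinv_gen) * e_free"

definition z_free :: daha_free where
  "z_free = (cst q_half * gen Y_gen * gen X_gen + cst (inverse q_half) * gen Xinv_gen * gen Yinv_gen) * e_free"

definition z'_free :: daha_free where
  "z'_free = cst (inverse (q_half + inverse q_half)) * (x_free * y_free + y_free * x_free) - z_free"

definition daha_e :: "daha_free set" where
  "daha_e = pres_class daha_rels e_free"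

definition SH :: "daha_free set ring" where
  "SH = DAHA\<lparr>carrier := {daha_e \<otimes>\<^bsub>DAHA\<^esub> h \<otimes>\<^bsub>DAHA\<^esub> daha_e | h. h \<in> carrier DAHA}, one := daha_e\<rparr>"

text \<open>The structure map of \<open>SH\<close> is \<open>c \<mapsto> c \<cdot> e\<close>, as \<open>e\<close> is its unit.\<close>

definition sh_scalar :: "Cqt \<Rightarrow> daha_free set" where
  "sh_scalar c = pres_class daha_rels (cst c * e_free)"

definition sh_x :: "daha_free set" where
  "sh_x = pres_class daha_rels x_free"

definition sh_y :: "daha_free set" where
  "sh_y = pres_class daha_rels y_free"

definition sh_z :: "daha_free set" where
  "sh_z = pres_class daha_rels z_free"

definition sh_z' :: "daha_free set" where
  "sh_z' = pres_class daha_rels z'_free"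


section \<open>The modular group and its actions\<close>

definition SL2Z :: "(int^2^2) monoid" where
  "SL2Z = \<lparr>carrier = {M. det M = 1}, mult = (**), one = mat 1\<rparr>"

definition tau_plus :: "int^2^2" where
  "tau_plus = vector [vector [1, 1], vector [0, 1]]"

definition tau_minus :: "int^2^2" where
  "tau_minus = vector [vector [1, 0], vector [1, 1]]"

definition sigma :: "int^2^2" where
  "sigma = tau_plus \<otimes>\<^bsub>SL2Z\<^esub> inv\<^bsub>SL2Z\<^esub> tau_minus \<otimes>\<^bsub>SL2Z\<^esub> tau_plus"

text \<open>As \<open>tau_plus\<close> and \<open>tau_minus\<close> generate \<open>SL2Z\<close>, each of the two predicates below determines
  the action on the subalgebra generated by the listed elements.\<close>

definition skein_SL2Z_action :: "(int^2^2 \<Rightarrow> skein_free set \<Rightarrow> skein_free set) \<Rightarrow> bool" where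
  "skein_SL2Z_action \<rho> \<longleftrightarrow>
     acts_by_alg_automorphisms SL2Z sk_scalar Sk \<rho> \<and>
     \<rho> tau_plus sk_alpha = sk_alpha \<and> \<rho> tau_plus sk_beta = sk_gamma_minus1 \<and> \<rho> tau_plus sk_gamma = sk_beta \<and>
     \<rho> tau_minus sk_alpha = sk_gamma_minus1 \<and> \<rho> tau_minus sk_beta = sk_beta \<and> \<rho> tau_minus sk_gamma = sk_alpha \<and>
     \<rho> sigma sk_alpha = sk_beta \<and> \<rho> sigma sk_beta = sk_alpha \<and> \<rho> sigma sk_gamma = sk_gamma_minus1"

definition SH_SL2Z_action :: "(int^2^2 \<Rightarrow> daha_free set \<Rightarrow> daha_free set) \<Rightarrow> bool" where
  "SH_SL2Z_action \<rho> \<longleftrightarrow>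
     acts_by_alg_automorphisms SL2Z sh_scalar SH \<rho> \<and>
     \<rho> tau_plus sh_x = sh_x \<and> \<rho> tau_plus sh_y = sh_z' \<and> \<rho> tau_plus sh_z = sh_y \<and>
     \<rho> tau_minus sh_x = sh_z' \<and> \<rho> tau_minus sh_y = sh_y \<and> \<rho> tau_minus sh_z = sh_x \<and>
     \<rho> sigma sh_x = sh_y \<and> \<rho> sigma sh_y = sh_x \<and> \<rho> sigma sh_z = sh_z'"

end

theory Submission
  imports Defs "HOL-Algebra.Generated_Groups"
begin

text \<open>
  Equivariance can be tested on generators of everything in sight. For a single group element \<open>g\<close>,
  both \<open>s \<mapsto> \<phi> (g s)\<close> and \<open>s \<mapsto> g (\<phi> s)\<close> are unital ring homomorphisms out of a presented algebra,
  so they coincide as soon as they agree on the scalars and on \<open>\<alpha>\<close>, \<open>\<beta>\<close>, \<open>\<gamma>\<close>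
  (\<open>presented_alg_hom_eqI\<close>). The elements \<open>g\<close> for which they coincide are closed under products and
  inverses (\<open>equivariant_generate\<close>), and the Euclidean algorithm shows that the two Dehn twists
  generate the modular group (\<open>SL2Z_generated\<close>). It remains to look at \<open>\<tau>\<^sub>+\<close> and \<open>\<tau>\<^sub>-\<close> only.

  On generators the two actions are given by the same formulas, with the skein \<open>\<gamma>\<^sub>-\<^sub>1\<close> on one side
  and \<open>z'\<close> on the other, so the heart of the matter is \<open>\<phi> \<gamma>\<^sub>-\<^sub>1 = z'\<close> (\<open>hom_gamma_minus1\<close>).
  Writing \<open>h\<close> for \<open>q\<^sup>1\<^sup>/\<^sup>2\<close>, the definition of \<open>\<gamma>\<^sub>-\<^sub>1\<close> gives
  \<open>\<phi> \<gamma>\<^sub>-\<^sub>1 = h x y - h\<^sup>2 z\<close>, while the first skein relation is carried to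
  \<open>h x y - h\<^sup>-\<^sup>1 y x = (h\<^sup>2 - h\<^sup>-\<^sup>2) z\<close>. Solving the latter for \<open>y x\<close> and substituting into
  \<open>z' = (x y + y x) / (h + h\<^sup>-\<^sup>1) - z\<close> gives the former. This uses that \<open>e\<close> acts as a unit
  on \<open>x\<close>, \<open>y\<close>, \<open>z\<close>, which is part of \<open>\<phi>\<close> being unital (\<open>e_hom\<close>).

  The scalars need an argument because the two actions are linear over different rings: \<open>\<phi>\<close> is only
  linear over the complex numbers, and one has to see that it sends every Laurent polynomial in
  \<open>A\<close>, \<open>\<lambda>\<close> to a scalar of the spherical algebra (\<open>hom_scalar\<close>).
\<close>

section \<open>Homomorphisms out of a presented algebra\<close>

lemma ring_free_alg: "ring (free_alg :: ('g word \<Rightarrow>\<^sub>0 'r::comm_ring_1) ring)"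
proof (rule ringI)
  show "abelian_group (free_alg :: ('g word \<Rightarrow>\<^sub>0 'r) ring)"
  proof (rule abelian_groupI)
    fix p :: "'g word \<Rightarrow>\<^sub>0 'r"
    show "\<exists>q\<in>carrier free_alg. q \<oplus>\<^bsub>free_alg\<^esub> p = \<zero>\<^bsub>free_alg\<^esub>"
      by (rule bexI[of _ "- p"]) (simp_all add: free_alg_def)
  qed (simp_all add: free_alg_def algebra_simps)
  show "monoid (free_alg :: ('g word \<Rightarrow>\<^sub>0 'r) ring)"
    by (rule monoidI) (simp_all add: free_alg_def algebra_simps)
qed (simp_all add: free_alg_def algebra_simps)

lemma ideal_rels: "ideal (Idl\<^bsub>free_alg\<^esub> rels) (free_alg :: ('g word \<Rightarrow>\<^sub>0 'r::comm_ring_1) ring)"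
  by (rule ring.genideal_ideal[OF ring_free_alg]) (simp add: free_alg_def)

lemma ring_presented_alg: "ring (presented_alg rels)"
  unfolding presented_alg_def by (rule ideal.quotient_is_ring[OF ideal_rels])

lemma pres_class_hom: "pres_class rels \<in> ring_hom free_alg (presented_alg rels)"
  unfolding presented_alg_def pres_class_def by (rule ideal.rcos_ring_hom[OF ideal_rels])

lemma
  shows pres_class_closed [simp]: "pres_class rels p \<in> carrier (presented_alg rels)"
    and pres_class_mult: "pres_class rels (p * q) = pres_class rels p \<otimes>\<^bsub>presented_alg rels\<^esub> pres_class rels q"
    and pres_class_add: "pres_class rels (p + q) = pres_class rels p \<oplus>\<^bsub>presented_alg rels\<^esub> pres_class rels q"
    and pres_class_one: "pres_class rels 1 = \<one>\<^bsub>presented_alg rels\<^esub>"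
  using ring_hom_closed[OF pres_class_hom, of p rels] ring_hom_mult[OF pres_class_hom, of p q rels]
    ring_hom_add[OF pres_class_hom, of p q rels] ring_hom_one[OF pres_class_hom, of rels]
  by (simp_all add: free_alg_def)

lemma pres_class_mult_cong:
  "pres_class rels p = pres_class rels q \<Longrightarrow> pres_class rels (r * p) = pres_class rels (r * q)"
  by (simp add: pres_class_mult)

lemma pres_class_add_cong:
  "pres_class rels p = pres_class rels q \<Longrightarrow> pres_class rels (r + p) = pres_class rels (r + q)"
  by (simp add: pres_class_add)

lemma carrier_presented_alg: "carrier (presented_alg rels) = range (pres_class rels)"
  by (auto simp: presented_alg_def pres_class_def FactRing_def A_RCOSETS_def' free_alg_def)

lemma pres_class_eqI:
  assumes "p - q \<in> rels"
  shows "pres_class rels p = pres_class rels q"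
proof -
  interpret I: ideal "Idl\<^bsub>free_alg\<^esub> rels" free_alg by (rule ideal_rels)
  interpret Q: ring "presented_alg rels" by (rule ring_presented_alg)
  have "p - q \<in> Idl\<^bsub>free_alg\<^esub> rels"
    using ring.genideal_self[OF ring_free_alg, of rels] assms by (auto simp: free_alg_def)
  then have "pres_class rels (p - q) = \<zero>\<^bsub>presented_alg rels\<^esub>"
    by (simp add: pres_class_def presented_alg_def FactRing_def I.a_rcos_const)
  then show ?thesis
    using pres_class_add[of rels "p - q" q] by simp
qed

lemma cst_add: "cst (a + b) = cst a + cst b"
  by (simp add: cst_def single_add)

lemma cst_mult: "cst (a * b) = cst a * cst b"
  by (simp add: cst_def mult_single)

lemma cst_one: "cst 1 = 1"
  by (simp add: cst_def)

lemma cst_uminus: "cst (- a) = - cst a"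
  by (simp add: cst_def single_uminus)

lemma cst_diff: "cst (a - b) = cst a - cst b"
  by (simp add: cst_def single_diff)

lemma poly_mapping_single_add_induct [case_names single add]:
  fixes p :: "'a \<Rightarrow>\<^sub>0 'b::monoid_add"
  assumes single: "\<And>k v. P (Poly_Mapping.single k v)"
    and add: "\<And>p q. P p \<Longrightarrow> P q \<Longrightarrow> P (p + q)"
  shows "P p"
proof (induction p rule: update_induct)
  case const
  show ?case using single[of undefined 0] by simp
next
  case (update f a b)
  have "Poly_Mapping.update a b f = f + Poly_Mapping.single a b"
    using update(1)
    by (intro poly_mapping_eqI) (auto simp: lookup_update lookup_add lookup_single not_in_keys_iff_lookup_eq_zero)
  then show ?case using add[OF update(3) single] by simp
qed

lemma cst_commute: "p * cst c = cst c * p"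
proof (induction p rule: poly_mapping_single_add_induct)
  case (single k v)
  then show ?case by (simp add: cst_def mult_single mult.commute)
next
  case (add f g)
  then show ?case by (simp add: algebra_simps)
qed

text \<open>Every element of the free algebra is a sum of multiples of words, and a word is a product of
  generators; the unit is the scalar \<open>1\<close>.\<close>

lemma free_alg_induct [case_names cst gen add mult]:
  fixes p :: "'g word \<Rightarrow>\<^sub>0 'r::comm_ring_1"
  assumes cst: "\<And>c. P (cst c)" and gen: "\<And>a. P (gen a)"
    and add: "\<And>p q. P p \<Longrightarrow> P q \<Longrightarrow> P (p + q)"
    and mult: "\<And>p q. P p \<Longrightarrow> P q \<Longrightarrow> P (p * q)"
  shows "P p"
proof (induction p rule: poly_mapping_single_add_induct)
  case (single w c)
  have "P (Poly_Mapping.single (Word as) (1::'r))" for as :: "'g list"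
  proof (induction as)
    case Nil
    then show ?case using cst[of 1] by (simp add: cst_def zero_word_def)
  next
    case (Cons a as)
    have "Poly_Mapping.single (Word (a # as)) (1::'r) = gen a * Poly_Mapping.single (Word as) 1"
      by (simp add: gen_def mult_single plus_word_def)
    then show ?case using mult[OF gen Cons] by simp
  qed
  from mult[OF cst[of c] this[of "letters w"]] show ?case
    by (simp add: cst_def mult_single)
next
  case (add f g)
  then show ?case by (rule assms)
qed

text \<open>The elements on which \<open>f\<close> and \<open>g\<close> agree are closed under sums and products, so the induction
  principle for the free algebra applies.\<close>

lemma presented_alg_hom_eqI:
  assumes f: "f \<in> ring_hom (presented_alg rels) S" and g: "g \<in> ring_hom (presented_alg rels) S"
    and scalars: "\<And>c. f (pres_class rels (cst c)) = g (pres_class rels (cst c))"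
    and gens: "\<And>a. f (pres_class rels (gen a)) = g (pres_class rels (gen a))"
    and s: "s \<in> carrier (presented_alg rels)"
  shows "f s = g s"
proof -
  obtain p where p: "s = pres_class rels p"
    using s by (auto simp: carrier_presented_alg)
  have "f (pres_class rels p) = g (pres_class rels p)"
    by (induction p rule: free_alg_induct)
      (simp_all add: scalars gens pres_class_add pres_class_mult
        ring_hom_add[OF f] ring_hom_add[OF g] ring_hom_mult[OF f] ring_hom_mult[OF g])
  then show ?thesis using p by simp
qed

section \<open>Generation of the modular group by the two Dehn twists\<close>

abbreviation mat2 :: "int \<Rightarrow> int \<Rightarrow> int \<Rightarrow> int \<Rightarrow> int^2^2" where
  "mat2 a b c d \<equiv> vector [vector [a, b], vector [c, d]]"

lemma mat2_mult:
  "mat2 a b c d ** mat2 a' b' c' d' =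
     mat2 (a * a' + b * c') (a * b' + b * d') (c * a' + d * c') (c * b' + d * d')"
  by (simp add: matrix_matrix_mult_def vec_eq_iff forall_2 sum_2)

lemma det_mat2: "det (mat2 a b c d) = a * d - b * c"
  by (simp add: det_2)

lemma mat2_exhaust: obtains a b c d where "M = mat2 a b c d"
proof
  show "M = mat2 (M$1$1) (M$1$2) (M$2$1) (M$2$2)"
    by (simp add: vec_eq_iff forall_2)
qed

lemma mat2_one: "mat 1 = mat2 1 0 0 1"
  by (simp add: mat_def vec_eq_iff forall_2)

lemma group_SL2Z: "group SL2Z"
proof (rule groupI)
  fix M assume "M \<in> carrier SL2Z"
  moreover obtain a b c d where "M = mat2 a b c d" by (rule mat2_exhaust)
  ultimately show "\<exists>N\<in>carrier SL2Z. N \<otimes>\<^bsub>SL2Z\<^esub> M = \<one>\<^bsub>SL2Z\<^esub>"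
    by (intro bexI[of _ "mat2 d (- b) (- c) a"])
      (simp_all add: SL2Z_def mat2_mult mat2_one det_mat2 algebra_simps)
qed (simp_all add: SL2Z_def det_mul matrix_mul_assoc)

lemma inv_SL2Z:
  assumes "a * d - b * c = 1"
  shows "inv\<^bsub>SL2Z\<^esub> (mat2 a b c d) = mat2 d (- b) (- c) a"
  using assms
  by (intro group.inv_equality[OF group_SL2Z])
    (simp_all add: SL2Z_def mat2_mult mat2_one det_mat2 algebra_simps)

text \<open>Left multiplication by the twists and their inverses performs the Euclidean algorithm on the first
  column, until one of its entries vanishes. If it is the lower entry, the matrix is a
  shear up to sign; if it is the upper one, a quarter turn exchanges the two entries up to sign.\<close>

lemma SL2Z_generated: "generate SL2Z {tau_plus, tau_minus} = carrier SL2Z"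
proof
  let ?G = "generate SL2Z {tau_plus, tau_minus}"
  have "{tau_plus, tau_minus} \<subseteq> carrier SL2Z"
    by (simp add: SL2Z_def tau_plus_def tau_minus_def det_mat2)
  then show "?G \<subseteq> carrier SL2Z"
    by (rule group.generate_incl[OF group_SL2Z])
  have mult: "M ** N \<in> ?G" if "M \<in> ?G" "N \<in> ?G" for M N
    using generate.eng[OF that] by (simp add: SL2Z_def)
  have one: "mat2 1 0 0 1 \<in> ?G"
    using generate.one[of SL2Z "{tau_plus, tau_minus}"] by (simp add: SL2Z_def mat2_one)
  have p: "mat2 1 1 0 1 \<in> ?G" and m: "mat2 1 0 1 1 \<in> ?G"
    by (auto intro: generate.incl simp: tau_plus_def tau_minus_def)
  have p': "mat2 1 (-1) 0 1 \<in> ?G" and m': "mat2 1 0 (-1) 1 \<in> ?G"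
    using generate.inv[of tau_plus "{tau_plus, tau_minus}" SL2Z]
      generate.inv[of tau_minus "{tau_plus, tau_minus}" SL2Z]
    by (simp_all add: tau_plus_def tau_minus_def inv_SL2Z)
  have shear: "mat2 1 k 0 1 \<in> ?G" for k
  proof (induction k rule: int_induct[where k = 0])
    case (step1 i)
    from mult[OF p this(2)] show ?case by (simp add: mat2_mult add.commute)
  next
    case (step2 i)
    from mult[OF p' this(2)] show ?case by (simp add: mat2_mult)
  qed (rule one)
  have rot: "mat2 0 1 (-1) 0 \<in> ?G"
    using mult[OF p mult[OF m' p]] by (simp add: mat2_mult)
  have minus: "mat2 (-1) k 0 (-1) \<in> ?G" for k
    using mult[OF rot mult[OF rot shear[of "- k"]]] by (simp add: mat2_mult)
  have "mat2 a b c d \<in> ?G" if "a * d - b * c = 1" for a b c d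
    using that
  proof (induction "nat (\<bar>a\<bar> + \<bar>c\<bar>)" arbitrary: a b c d rule: less_induct)
    case less
    have IH: "mat2 a' b' c' d' \<in> ?G"
      if "\<bar>a'\<bar> + \<bar>c'\<bar> < \<bar>a\<bar> + \<bar>c\<bar>" "a' * d' - b' * c' = 1" for a' b' c' d'
      using less.hyps[of a' c' d' b'] that by auto
    have upper: "mat2 a' b' 0 d' \<in> ?G" if "a' * d' = 1" for a' b' d'
    proof -
      have "a' = 1 \<and> d' = 1 \<or> a' = -1 \<and> d' = -1"
        using that zmult_eq_1_iff by blast
      then show ?thesis using shear minus by auto
    qed
    have row1: "mat2 a b c d \<in> ?G" if "mat2 (a - c) (b - d) c d \<in> ?G"
      using mult[OF p that] by (simp add: mat2_mult)
    have row1': "mat2 a b c d \<in> ?G" if "mat2 (a + c) (b + d) c d \<in> ?G"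
      using mult[OF p' that] by (simp add: mat2_mult)
    have row2: "mat2 a b c d \<in> ?G" if "mat2 a b (c - a) (d - b) \<in> ?G"
      using mult[OF m that] by (simp add: mat2_mult)
    have row2': "mat2 a b c d \<in> ?G" if "mat2 a b (c + a) (d + b) \<in> ?G"
      using mult[OF m' that] by (simp add: mat2_mult)
    \<comment> \<open>Adding the smaller entry, with a suitable sign, to the larger one shrinks the column.\<close>
    consider "c = 0" | "a = 0"
      | "c \<noteq> 0" "\<bar>a - c\<bar> < \<bar>a\<bar>" | "c \<noteq> 0" "\<bar>a + c\<bar> < \<bar>a\<bar>"
      | "a \<noteq> 0" "\<bar>c - a\<bar> < \<bar>c\<bar>" | "a \<noteq> 0" "\<bar>c + a\<bar> < \<bar>c\<bar>"
      by linarith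
    then show ?case
    proof cases
      case 1
      then show ?thesis using upper less.prems by simp
    next
      case 2
      then have "mat2 (- c) (- d) 0 b \<in> ?G"
        using upper less.prems by (simp add: algebra_simps)
      from mult[OF rot this] show ?thesis using 2 by (simp add: mat2_mult)
    next
      case 3
      then show ?thesis using less.prems by (intro row1 IH) (simp_all add: algebra_simps)
    next
      case 4
      then show ?thesis using less.prems by (intro row1' IH) (simp_all add: algebra_simps)
    next
      case 5
      then show ?thesis using less.prems by (intro row2 IH) (simp_all add: algebra_simps)
    next
      case 6
      then show ?thesis using less.prems by (intro row2' IH) (simp_all add: algebra_simps)
    qed
  qed
  then show "carrier SL2Z \<subseteq> ?G"
    by (metis (mono_tags, lifting) CollectD SL2Z_def det_mat2 mat2_exhaust partial_object.select_convs(1) subsetI)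
qed

lemma group_action_inv_cancel:
  assumes "group_action G E \<rho>" "g \<in> carrier G" "x \<in> E"
  shows "\<rho> (inv\<^bsub>G\<^esub> g) (\<rho> g x) = x" and "\<rho> g (\<rho> (inv\<^bsub>G\<^esub> g) x) = x"
proof -
  interpret group_action G E \<rho> by fact
  interpret group G by (rule group_hom.axioms(1)[OF group_hom])
  show "\<rho> (inv\<^bsub>G\<^esub> g) (\<rho> g x) = x" using orbit_sym_aux assms by blast
  from orbit_sym_aux[OF inv_closed[OF assms(2)] assms(3)] show "\<rho> g (\<rho> (inv\<^bsub>G\<^esub> g) x) = x"
    using assms by simp
qed

text \<open>Equivariance passes to inverses by applying it for \<open>h\<close> at the point \<open>h\<^sup>-\<^sup>1 s\<close> and cancelling.\<close>

lemma equivariant_generate: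
  assumes act: "group_action G E \<rho>" and act': "group_action G E' \<rho>'"
    and f: "f \<in> E \<rightarrow> E'" and K: "K \<subseteq> carrier G"
    and gens: "\<And>k s. k \<in> K \<Longrightarrow> s \<in> E \<Longrightarrow> f (\<rho> k s) = \<rho>' k (f s)"
    and g: "g \<in> generate G K" and s: "s \<in> E"
  shows "f (\<rho> g s) = \<rho>' g (f s)"
proof -
  interpret group_action G E \<rho> by fact
  interpret A': group_action G E' \<rho>' by fact
  interpret group G by (rule group_hom.axioms(1)[OF group_hom])
  show ?thesis using g s
  proof (induction arbitrary: s rule: generate.induct)
    case one
    then show ?case using f id_eq_one A'.id_eq_one by (metis Pi_mem restrict_apply')
  next
    case (incl h)
    then show ?case by (rule gens)
  next
    case (inv h)
    then have h: "h \<in> carrier G" using K by blast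
    have "\<rho> (inv\<^bsub>G\<^esub> h) s \<in> E" by (rule element_image[OF inv_closed[OF h] inv(2) refl])
    then show ?case
      using gens[OF inv(1), of "\<rho> (inv\<^bsub>G\<^esub> h) s"]
        group_action_inv_cancel[OF act h inv(2)] group_action_inv_cancel(1)[OF act' h] f
      by (metis Pi_mem)
  next
    case (eng h1 h2)
    have h: "h1 \<in> carrier G" "h2 \<in> carrier G" using eng(1,2) generate_in_carrier[OF K] by auto
    then have "\<rho> h2 s \<in> E" using eng element_image by blast
    then show ?case
      using eng h A'.composition_rule[OF Pi_mem[OF f eng(5)] h] by (simp add: composition_rule)
  qed
qed

section \<open>The scalars and the class of the curve \<open>\<gamma>\<^sub>-\<^sub>1\<close> under the embedding\<close>

lemma sk_scalar_add: "sk_scalar (a + b) = sk_scalar a \<oplus>\<^bsub>Sk\<^esub> sk_scalar b"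
  by (simp add: sk_scalar_def Sk_def cst_add pres_class_add)

lemma sk_scalar_mult: "sk_scalar (a * b) = sk_scalar a \<otimes>\<^bsub>Sk\<^esub> sk_scalar b"
  by (simp add: sk_scalar_def Sk_def cst_mult pres_class_mult)

lemma sk_scalar_one: "sk_scalar 1 = \<one>\<^bsub>Sk\<^esub>"
  by (simp add: sk_scalar_def Sk_def cst_one pres_class_one)

lemma sk_scalar_closed: "sk_scalar a \<in> carrier Sk"
  by (simp add: sk_scalar_def Sk_def)

lemma SH_simps [simp]:
  "mult SH = mult DAHA" "add SH = add DAHA" "\<one>\<^bsub>SH\<^esub> = daha_e"
  by (simp_all add: SH_def)

lemma ring_DAHA: "ring DAHA"
  unfolding DAHA_def by (rule ring_presented_alg)

lemma carrier_SH_subset: "carrier SH \<subseteq> carrier DAHA"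
proof -
  interpret ring DAHA by (rule ring_DAHA)
  have "daha_e \<in> carrier DAHA" by (simp add: daha_e_def DAHA_def)
  then show ?thesis by (auto simp: SH_def)
qed

lemma sh_scalar_add: "sh_scalar (a + b) = sh_scalar a \<oplus>\<^bsub>SH\<^esub> sh_scalar b"
  by (simp add: sh_scalar_def DAHA_def cst_add pres_class_add[symmetric] distrib_right)

lemma sh_scalar_one: "sh_scalar 1 = \<one>\<^bsub>SH\<^esub>"
  by (simp add: sh_scalar_def cst_one daha_e_def)

lemma q_half_nonzero: "q_half \<noteq> 0" and t_half_nonzero: "t_half \<noteq> 0"
  and q_half_sum_nonzero: "q_half + inverse q_half \<noteq> 0"
proof -
  show q: "q_half \<noteq> 0" and "t_half \<noteq> 0"
    by (simp_all add: q_half_def t_half_def Zero_fract_def eq_fract)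
  have "q_half * q_half + 1 \<noteq> 0"
    by (simp add: q_half_def Zero_fract_def One_fract_def eq_fract one_pCons)
  moreover have "q_half * (q_half + inverse q_half) = q_half * q_half + 1"
    using q by (simp add: distrib_left)
  ultimately show "q_half + inverse q_half \<noteq> 0" by auto
qed

lemma laurent_induct [case_names const A A_inverse lambda lambda_inverse add mult]:
  fixes c :: laurent
  assumes const: "\<And>z. P (laurent_const z)"
    and A: "P (A_pow 1)" "P (A_pow (-1))" and lambda: "P (lambda_pow 1)" "P (lambda_pow (-1))"
    and add: "\<And>a b. P a \<Longrightarrow> P b \<Longrightarrow> P (a + b)"
    and mult: "\<And>a b. P a \<Longrightarrow> P b \<Longrightarrow> P (a * b)"
  shows "P c"
proof (induction c rule: poly_mapping_single_add_induct)
  case (single k v)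
  have one: "P 1" using const[of 1] by (simp add: laurent_const_def)
  have "P (A_pow n)" for n
  proof (induction n rule: int_induct[where k = 0])
    case base
    show ?case using one by (simp add: A_pow_def flip: zero_prod_def)
  next
    case (step1 i)
    from mult[OF this(2) A(1)] show ?case by (simp add: A_pow_def mult_single)
  next
    case (step2 i)
    from mult[OF this(2) A(2)] show ?case by (simp add: A_pow_def mult_single)
  qed
  moreover have "P (lambda_pow n)" for n
  proof (induction n rule: int_induct[where k = 0])
    case base
    show ?case using one by (simp add: lambda_pow_def flip: zero_prod_def)
  next
    case (step1 i)
    from mult[OF this(2) lambda(1)] show ?case by (simp add: lambda_pow_def mult_single)
  next
    case (step2 i)
    from mult[OF this(2) lambda(2)] show ?case by (simp add: lambda_pow_def mult_single)
  qed
  ultimately have "P (laurent_const v * (A_pow (fst k) * lambda_pow (snd k)))"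
    by (intro mult const)
  then show ?case by (simp add: laurent_const_def A_pow_def lambda_pow_def mult_single)
next
  case (add p q)
  then show ?case by (rule assms)
qed

locale skein_to_SH_hom =
  fixes \<phi> :: "skein_free set \<Rightarrow> daha_free set"
  assumes alg_hom: "\<phi> \<in> alg_hom (\<lambda>c. sk_scalar (laurent_const c)) (\<lambda>c. sh_scalar (Cqt_const c)) Sk SH"
    and hom_A: "\<phi> (sk_scalar (A_pow 1)) = sh_scalar (inverse q_half)"
    and hom_lambda: "\<phi> (sk_scalar (lambda_pow 1)) = sh_scalar (inverse (q_half^2) * t_half^2)"
    and hom_alpha: "\<phi> sk_alpha = sh_x"
    and hom_beta: "\<phi> sk_beta = sh_y"
    and hom_gamma: "\<phi> sk_gamma = sh_z"
begin

lemma ring_hom: "\<phi> \<in> ring_hom Sk SH"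
  using alg_hom by (simp add: alg_hom_def)

lemma hom_const: "\<phi> (sk_scalar (laurent_const c)) = sh_scalar (Cqt_const c)"
  using alg_hom by (simp add: alg_hom_def)

lemma hom_representative:
  assumes "s \<in> carrier Sk"
  obtains p where "\<phi> s = pres_class daha_rels p"
  using ring_hom_closed[OF ring_hom assms] carrier_SH_subset
  by (auto simp: DAHA_def carrier_presented_alg)

text \<open>As \<open>\<phi>\<close> is unital, \<open>e \<phi>(s) = \<phi>(1) \<phi>(s) = \<phi>(1 s)\<close>; for \<open>s = 1\<close> this is the idempotence of \<open>e\<close>.\<close>

lemma e_hom:
  assumes "s \<in> carrier Sk"
  shows "daha_e \<otimes>\<^bsub>DAHA\<^esub> \<phi> s = \<phi> s"
proof -
  interpret Sk: ring Sk unfolding Sk_def by (rule ring_presented_alg)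
  show ?thesis
    using ring_hom_mult[OF ring_hom, of "\<one>\<^bsub>Sk\<^esub>" s] ring_hom_one[OF ring_hom] assms by simp
qed

lemma sh_scalar_mult_hom:
  assumes "s \<in> carrier Sk" and p: "\<phi> s = pres_class daha_rels p"
  shows "sh_scalar c \<otimes>\<^bsub>DAHA\<^esub> pres_class daha_rels p = pres_class daha_rels (cst c * p)"
proof -
  have "pres_class daha_rels (e_free * p) = pres_class daha_rels p"
    using e_hom[OF assms(1)] p by (simp add: daha_e_def DAHA_def pres_class_mult)
  moreover have "sh_scalar c \<otimes>\<^bsub>DAHA\<^esub> pres_class daha_rels p = pres_class daha_rels (cst c * (e_free * p))"
    by (simp add: sh_scalar_def DAHA_def mult.assoc flip: pres_class_mult)
  ultimately show ?thesis
    by (simp add: pres_class_mult)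
qed

lemma sh_scalar_mult: "sh_scalar (a * b) = sh_scalar a \<otimes>\<^bsub>SH\<^esub> sh_scalar b"
proof -
  interpret Sk: ring Sk unfolding Sk_def by (rule ring_presented_alg)
  have "daha_e \<otimes>\<^bsub>DAHA\<^esub> daha_e = daha_e"
    using e_hom[of "\<one>\<^bsub>Sk\<^esub>"] ring_hom_one[OF ring_hom] by simp
  then have idem: "pres_class daha_rels (e_free * e_free) = pres_class daha_rels e_free"
    by (simp add: daha_e_def DAHA_def pres_class_mult)
  have "cst a * e_free * (cst b * e_free) = cst a * (e_free * cst b) * e_free"
    by (simp only: mult.assoc)
  also have "\<dots> = cst (a * b) * (e_free * e_free)"
    by (simp only: cst_commute[of e_free] cst_mult mult.assoc)
  finally have "cst a * e_free * (cst b * e_free) = cst (a * b) * (e_free * e_free)" .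
  then have "sh_scalar a \<otimes>\<^bsub>SH\<^esub> sh_scalar b = pres_class daha_rels (cst (a * b) * (e_free * e_free))"
    by (simp add: sh_scalar_def DAHA_def flip: pres_class_mult)
  also have "\<dots> = sh_scalar (a * b)"
    by (simp add: sh_scalar_def pres_class_mult[of _ "cst _"] idem)
  finally show ?thesis by simp
qed

lemma hom_scalar_add:
  assumes "\<phi> (sk_scalar a) = sh_scalar a'" "\<phi> (sk_scalar b) = sh_scalar b'"
  shows "\<phi> (sk_scalar (a + b)) = sh_scalar (a' + b')"
  using assms ring_hom_add[OF ring_hom sk_scalar_closed sk_scalar_closed]
  by (simp add: sk_scalar_add sh_scalar_add)

lemma hom_scalar_mult:
  assumes "\<phi> (sk_scalar a) = sh_scalar a'" "\<phi> (sk_scalar b) = sh_scalar b'"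
  shows "\<phi> (sk_scalar (a * b)) = sh_scalar (a' * b')"
  using assms ring_hom_mult[OF ring_hom sk_scalar_closed sk_scalar_closed]
  by (simp add: sk_scalar_mult sh_scalar_mult)

lemma hom_scalar_uminus:
  assumes "\<phi> (sk_scalar a) = sh_scalar a'"
  shows "\<phi> (sk_scalar (- a)) = sh_scalar (- a')"
proof -
  have "laurent_const (-1) = -1"
    by (simp add: laurent_const_def single_uminus)
  moreover have "Cqt_const (-1) = -1"
    by (simp add: Cqt_const_def One_fract_def one_pCons)
  ultimately show ?thesis
    using hom_scalar_mult[OF hom_const[of "-1"] assms] by simp
qed

text \<open>Inverses in a monoid are unique, so an inverse of a scalar is again a scalar.\<close>

lemma hom_scalar_inverse:
  assumes u: "\<phi> (sk_scalar u) = sh_scalar c" and "c \<noteq> 0" and "u * v = 1"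
  shows "\<phi> (sk_scalar v) = sh_scalar (inverse c)"
proof -
  interpret D: ring DAHA by (rule ring_DAHA)
  have closed: "\<phi> (sk_scalar v) \<in> carrier DAHA" "sh_scalar d \<in> carrier DAHA" for d
    using ring_hom_closed[OF ring_hom sk_scalar_closed] carrier_SH_subset
    by (auto simp: sh_scalar_def DAHA_def)
  have "\<phi> (sk_scalar v) = sh_scalar (inverse c * c) \<otimes>\<^bsub>DAHA\<^esub> \<phi> (sk_scalar v)"
    using \<open>c \<noteq> 0\<close> e_hom[OF sk_scalar_closed] by (simp add: sh_scalar_one)
  also have "\<dots> = sh_scalar (inverse c) \<otimes>\<^bsub>DAHA\<^esub> (\<phi> (sk_scalar u) \<otimes>\<^bsub>DAHA\<^esub> \<phi> (sk_scalar v))"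
    using closed u by (simp add: sh_scalar_mult D.m_assoc)
  also have "\<phi> (sk_scalar u) \<otimes>\<^bsub>DAHA\<^esub> \<phi> (sk_scalar v) = sh_scalar 1"
    using ring_hom_mult[OF ring_hom sk_scalar_closed sk_scalar_closed, of u v] \<open>u * v = 1\<close>
      ring_hom_one[OF ring_hom]
    by (simp add: sk_scalar_one sh_scalar_one flip: sk_scalar_mult)
  also have "sh_scalar (inverse c) \<otimes>\<^bsub>DAHA\<^esub> sh_scalar 1 = sh_scalar (inverse c)"
    using sh_scalar_mult[of "inverse c" 1] by simp
  finally show ?thesis .
qed

lemma hom_A_inverse: "\<phi> (sk_scalar (A_pow (-1))) = sh_scalar q_half"
proof -
  have "A_pow 1 * A_pow (-1) = 1"
    by (simp add: A_pow_def mult_single flip: zero_prod_def)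
  from hom_scalar_inverse[OF hom_A _ this] show ?thesis
    by (simp add: q_half_nonzero)
qed

text \<open>A scalar of the spherical algebra is fixed by every automorphism of it that is linear over its
  own field, so this is what equivariance on the scalars of the skein algebra comes down to.\<close>

lemma hom_scalar: "\<exists>c'. \<phi> (sk_scalar c) = sh_scalar c'"
proof (induction c rule: laurent_induct)
  case (const z)
  show ?case using hom_const by blast
next
  case (add a b)
  then show ?case using hom_scalar_add by blast
next
  case (mult a b)
  then show ?case using hom_scalar_mult by blast
next
  case A
  show ?case using hom_A by blast
next
  case A_inverse
  show ?case using hom_A_inverse by blast
next
  case lambda
  show ?case using hom_lambda by blast
next
  case lambda_inverse
  have "lambda_pow 1 * lambda_pow (-1) = 1"
    by (simp add: lambda_pow_def mult_single flip: zero_prod_def)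
  from hom_scalar_inverse[OF hom_lambda _ this] show ?case
    using q_half_nonzero t_half_nonzero by auto
qed

text \<open>The next three rules compute \<open>\<phi>\<close> on representatives in the free algebras. The factor \<open>e\<close> that
  comes with each scalar is absorbed by the element it multiplies.\<close>

lemma hom_class_mult:
  assumes "\<phi> (pres_class skein_rels p) = pres_class daha_rels p'"
    and "\<phi> (pres_class skein_rels r) = pres_class daha_rels r'"
  shows "\<phi> (pres_class skein_rels (p * r)) = pres_class daha_rels (p' * r')"
  using assms ring_hom_mult[OF ring_hom, of "pres_class skein_rels p" "pres_class skein_rels r"]
  by (simp add: pres_class_mult Sk_def DAHA_def)

lemma hom_class_add:
  assumes "\<phi> (pres_class skein_rels p) = pres_class daha_rels p'"
    and "\<phi> (pres_class skein_rels r) = pres_class daha_rels r'"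
  shows "\<phi> (pres_class skein_rels (p + r)) = pres_class daha_rels (p' + r')"
  using assms ring_hom_add[OF ring_hom, of "pres_class skein_rels p" "pres_class skein_rels r"]
  by (simp add: pres_class_add Sk_def DAHA_def)

lemma hom_class_cst_mult:
  assumes "\<phi> (sk_scalar c) = sh_scalar c'"
    and p: "\<phi> (pres_class skein_rels p) = pres_class daha_rels p'"
  shows "\<phi> (pres_class skein_rels (cst c * p)) = pres_class daha_rels (cst c' * p')"
proof -
  have "\<phi> (pres_class skein_rels (cst c * p)) = sh_scalar c' \<otimes>\<^bsub>DAHA\<^esub> pres_class daha_rels p'"
    using assms ring_hom_mult[OF ring_hom, of "sk_scalar c" "pres_class skein_rels p"]
    by (simp add: pres_class_mult Sk_def sk_scalar_def)
  also have "\<dots> = pres_class daha_rels (cst c' * p')"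
    by (rule sh_scalar_mult_hom[OF _ p]) (simp add: Sk_def)
  finally show ?thesis .
qed

lemma hom_gens:
  "\<phi> (pres_class skein_rels (gen Alpha)) = pres_class daha_rels x_free"
  "\<phi> (pres_class skein_rels (gen Beta)) = pres_class daha_rels y_free"
  "\<phi> (pres_class skein_rels (gen Gamma)) = pres_class daha_rels z_free"
  using hom_alpha hom_beta hom_gamma
  by (simp_all add: sk_alpha_def sk_beta_def sk_gamma_def sh_x_def sh_y_def sh_z_def)

lemma hom_A_square: "\<phi> (sk_scalar (A_pow 2)) = sh_scalar (inverse q_half * inverse q_half)"
  using hom_scalar_mult[OF hom_A hom_A] by (simp add: A_pow_def mult_single)

lemma hom_A_inverse_square: "\<phi> (sk_scalar (A_pow (-2))) = sh_scalar (q_half * q_half)"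
  using hom_scalar_mult[OF hom_A_inverse hom_A_inverse] by (simp add: A_pow_def mult_single)

lemma hom_first_relation:
  "pres_class daha_rels (cst q_half * (x_free * y_free)) =
   pres_class daha_rels (cst (inverse q_half) * (y_free * x_free) +
     cst (q_half * q_half - inverse q_half * inverse q_half) * z_free)"
proof -
  have A2: "\<phi> (sk_scalar (A_pow (-2) + - A_pow 2)) =
      sh_scalar (q_half * q_half + - (inverse q_half * inverse q_half))"
    by (intro hom_scalar_add hom_scalar_uminus hom_A_square hom_A_inverse_square)
  have "pres_class skein_rels (cst (A_pow (-1)) * (gen Alpha * gen Beta)) =
      pres_class skein_rels (cst (A_pow 1) * (gen Beta * gen Alpha) +
        cst (A_pow (-2) + - A_pow 2) * gen Gamma)"
    by (rule pres_class_eqI) (simp add: skein_rels_def Let_def algebra_simps cst_diff)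
  then have "\<phi> (pres_class skein_rels (cst (A_pow (-1)) * (gen Alpha * gen Beta))) =
      \<phi> (pres_class skein_rels (cst (A_pow 1) * (gen Beta * gen Alpha) +
        cst (A_pow (-2) + - A_pow 2) * gen Gamma))"
    by (rule arg_cong)
  also have "\<dots> = pres_class daha_rels (cst (inverse q_half) * (y_free * x_free) +
     cst (q_half * q_half + - (inverse q_half * inverse q_half)) * z_free)"
    by (intro hom_class_add hom_class_cst_mult hom_class_mult hom_gens hom_A A2)
  also have "\<phi> (pres_class skein_rels (cst (A_pow (-1)) * (gen Alpha * gen Beta))) =
      pres_class daha_rels (cst q_half * (x_free * y_free))"
    by (intro hom_class_cst_mult hom_class_mult hom_gens hom_A_inverse)
  finally show ?thesis by simp
qed

text \<open>Dividing by \<open>q\<^sup>1\<^sup>/\<^sup>2 + q\<^sup>-\<^sup>1\<^sup>/\<^sup>2\<close> is possible in the field of scalars of the spherical algebra but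
  not in the skein algebra, so the symmetric description of \<open>\<gamma>\<^sub>-\<^sub>1\<close> is reached only after applying \<open>\<phi>\<close>.\<close>

lemma hom_gamma_minus1: "\<phi> sk_gamma_minus1 = sh_z'"
proof -
  define h where "h = inverse (q_half + inverse q_half)"
  define c where "c = q_half * q_half * q_half - inverse q_half"
  let ?P = "pres_class daha_rels"
  \<comment> \<open>The first skein relation, multiplied by \<open>q_half\<close> and solved for \<open>y x\<close>.\<close>
  have "?P (cst q_half * (cst q_half * (x_free * y_free))) =
      ?P (cst q_half * (cst (inverse q_half) * (y_free * x_free) +
        cst (q_half * q_half - inverse q_half * inverse q_half) * z_free))"
    by (intro pres_class_mult_cong hom_first_relation)
  also have "cst q_half * (cst (inverse q_half) * (y_free * x_free) +
        cst (q_half * q_half - inverse q_half * inverse q_half) * z_free) = y_free * x_free + cst c * z_free"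
    using q_half_nonzero
    by (simp add: c_def distrib_left right_diff_distrib cst_one flip: mult.assoc cst_mult)
  finally have "?P (cst q_half * (cst q_half * (x_free * y_free)) + cst (- c) * z_free) =
      ?P (y_free * x_free + cst c * z_free + cst (- c) * z_free)"
    by (simp only: pres_class_add)
  then have yx: "?P (y_free * x_free) = ?P (cst q_half * (cst q_half * (x_free * y_free)) + cst (- c) * z_free)"
    by (simp add: cst_uminus)
  \<comment> \<open>The coefficients of \<open>x y\<close> and \<open>z\<close> in \<open>z'\<close> once \<open>y x\<close> has been eliminated.\<close>
  have h: "h * (q_half + inverse q_half) = 1"
    using q_half_sum_nonzero by (simp add: h_def)
  have "1 + q_half * q_half = (q_half + inverse q_half) * q_half"
    using q_half_nonzero by (simp add: distrib_right)
  then have "h * (1 + q_half * q_half) = q_half"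
    by (simp only: h mult_1 flip: mult.assoc)
  then have q1: "h + h * (q_half * q_half) = q_half"
    by (simp only: distrib_left mult_1_right)
  have "c = (q_half + inverse q_half) * (q_half * q_half - 1)"
    using q_half_nonzero by (simp add: c_def distrib_right right_diff_distrib mult.assoc)
  then have "h * c = q_half * q_half - 1"
    by (simp only: h mult_1 flip: mult.assoc)
  then have q2: "h * (- c) + (-1) = - (q_half * q_half)"
    by simp
  have "sh_z' = ?P (cst h * (x_free * y_free) + cst (-1) * z_free + cst h * (y_free * x_free))"
    by (simp add: sh_z'_def z'_free_def h_def cst_uminus cst_one algebra_simps)
  also have "\<dots> = ?P (cst h * (x_free * y_free) + cst (-1) * z_free +
      cst h * (cst q_half * (cst q_half * (x_free * y_free)) + cst (- c) * z_free))"
    by (intro pres_class_add_cong pres_class_mult_cong yx)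
  also have "cst h * (x_free * y_free) + cst (-1) * z_free +
      cst h * (cst q_half * (cst q_half * (x_free * y_free)) + cst (- c) * z_free) =
      cst (h + h * (q_half * q_half)) * (x_free * y_free) + cst (h * (- c) + (-1)) * z_free"
    by (simp only: cst_add cst_mult distrib_left distrib_right mult.assoc ac_simps(1-3))
  also have "?P \<dots> = ?P (cst q_half * (x_free * y_free) + cst (- (q_half * q_half)) * z_free)"
    by (simp only: q1 q2)
  also have "\<dots> = \<phi> (pres_class skein_rels (cst (A_pow (-1)) * (gen Alpha * gen Beta) + cst (- A_pow (-2)) * gen Gamma))"
    by (intro sym[OF hom_class_add] hom_class_cst_mult hom_class_mult hom_gens hom_A_inverse
        hom_A_inverse_square hom_scalar_uminus)
  also have "\<dots> = \<phi> sk_gamma_minus1"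
    by (simp add: sk_gamma_minus1_def cst_uminus mult.assoc)
  finally show ?thesis ..
qed

lemma hom_intertwines:
  assumes f: "f \<in> alg_hom sk_scalar sk_scalar Sk Sk" and g: "g \<in> alg_hom sh_scalar sh_scalar SH SH"
    and gens: "\<phi> (f sk_alpha) = g sh_x" "\<phi> (f sk_beta) = g sh_y" "\<phi> (f sk_gamma) = g sh_z"
    and s: "s \<in> carrier Sk"
  shows "\<phi> (f s) = g (\<phi> s)"
proof -
  have f': "f \<in> ring_hom Sk Sk" and g': "g \<in> ring_hom SH SH"
    using f g by (simp_all add: alg_hom_def)
  have "(\<phi> \<circ> f) s = (g \<circ> \<phi>) s"
  proof (rule presented_alg_hom_eqI[where f = "\<phi> \<circ> f" and g = "g \<circ> \<phi>"])
    show "\<phi> \<circ> f \<in> ring_hom (presented_alg skein_rels) SH"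
      using ring_hom_trans[OF f' ring_hom] by (simp add: Sk_def)
    show "g \<circ> \<phi> \<in> ring_hom (presented_alg skein_rels) SH"
      using ring_hom_trans[OF ring_hom g'] by (simp add: Sk_def)
    show "(\<phi> \<circ> f) (pres_class skein_rels (cst c)) = (g \<circ> \<phi>) (pres_class skein_rels (cst c))" for c
    proof -
      obtain c' where "\<phi> (sk_scalar c) = sh_scalar c'" using hom_scalar by blast
      then show ?thesis using f g by (simp add: alg_hom_def flip: sk_scalar_def)
    qed
    show "(\<phi> \<circ> f) (pres_class skein_rels (gen a)) = (g \<circ> \<phi>) (pres_class skein_rels (gen a))" for a
      using gens hom_alpha hom_beta hom_gamma
      by (cases a) (simp_all add: sk_alpha_def sk_beta_def sk_gamma_def)
    show "s \<in> carrier (presented_alg skein_rels)" using s by (simp add: Sk_def)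
  qed
  then show ?thesis by simp
qed

end

section \<open>Equivariance\<close>

theorem proposition2p5:
  fixes \<phi> :: "skein_free set \<Rightarrow> daha_free set"
    and \<rho>_Sk :: "int^2^2 \<Rightarrow> skein_free set \<Rightarrow> skein_free set"
    and \<rho>_SH :: "int^2^2 \<Rightarrow> daha_free set \<Rightarrow> daha_free set"
  assumes "\<phi> \<in> alg_hom (\<lambda>c. sk_scalar (laurent_const c)) (\<lambda>c. sh_scalar (Cqt_const c)) Sk SH"
    and "inj_on \<phi> (carrier Sk)"
    and "\<phi> (sk_scalar (A_pow 1)) = sh_scalar (inverse q_half)"
    and "\<phi> (sk_scalar (lambda_pow 1)) = sh_scalar (inverse (q_half^2) * t_half^2)"
    and "\<phi> sk_alpha = sh_x"
    and "\<phi> sk_beta = sh_y"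
    and "\<phi> sk_gamma = sh_z"
    and "skein_SL2Z_action \<rho>_Sk"
    and "SH_SL2Z_action \<rho>_SH"
  shows "\<forall>g\<in>carrier SL2Z. \<forall>s\<in>carrier Sk. \<phi> (\<rho>_Sk g s) = \<rho>_SH g (\<phi> s)"
proof (intro ballI)
  interpret skein_to_SH_hom \<phi>
    using assms by unfold_locales
  fix g s assume g: "g \<in> carrier SL2Z" and s: "s \<in> carrier Sk"
  have twists: "tau_plus \<in> carrier SL2Z" "tau_minus \<in> carrier SL2Z"
    by (simp_all add: SL2Z_def tau_plus_def tau_minus_def det_mat2)
  have act: "group_action SL2Z (carrier Sk) \<rho>_Sk" "group_action SL2Z (carrier SH) \<rho>_SH"
    and automorphisms: "\<And>k. k \<in> carrier SL2Z \<Longrightarrow> \<rho>_Sk k \<in> alg_hom sk_scalar sk_scalar Sk Sk"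
      "\<And>k. k \<in> carrier SL2Z \<Longrightarrow> \<rho>_SH k \<in> alg_hom sh_scalar sh_scalar SH SH"
    using assms(8,9)
    by (simp_all add: skein_SL2Z_action_def SH_SL2Z_action_def acts_by_alg_automorphisms_def)
  show "\<phi> (\<rho>_Sk g s) = \<rho>_SH g (\<phi> s)"
  proof (rule equivariant_generate[OF act])
    show "\<phi> \<in> carrier Sk \<rightarrow> carrier SH"
      using ring_hom_closed[OF ring_hom] by blast
    show "{tau_plus, tau_minus} \<subseteq> carrier SL2Z" using twists by simp
    show "g \<in> generate SL2Z {tau_plus, tau_minus}" using g SL2Z_generated by simp
    show "s \<in> carrier Sk" by fact
    show "\<phi> (\<rho>_Sk k s') = \<rho>_SH k (\<phi> s')" if "k \<in> {tau_plus, tau_minus}" and s': "s' \<in> carrier Sk" for k s'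
    proof (rule hom_intertwines[OF automorphisms _ _ _ s'])
      show "k \<in> carrier SL2Z" "k \<in> carrier SL2Z" using that(1) twists by auto
      show "\<phi> (\<rho>_Sk k sk_alpha) = \<rho>_SH k sh_x" "\<phi> (\<rho>_Sk k sk_beta) = \<rho>_SH k sh_y"
        "\<phi> (\<rho>_Sk k sk_gamma) = \<rho>_SH k sh_z"
        using that(1) assms(8,9) hom_alpha hom_beta hom_gamma_minus1
        by (auto simp: skein_SL2Z_action_def SH_SL2Z_action_def)
    qed
  qed
qed

end
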